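(* Let $\mathcal N$ and $\mathcal N'$ be two one-counter nets in normal form, with sets of control states $Q$ and $Q'$, and let $C$ be $1$ plus the maximal length of an acyclic path in the product graph of $\mathcal N$ and $\mathcal N'$ (so $C\le|Q\times Q'|$). Then for every pair $(q,q')\in Q\times Q'$ there is a positive vector $(\rho,\rho')\in\mathbb N^2$ such that: (1) if $(n,n')$ is $C$-above $(\rho,\rho')$ then $qn\preceq q'n'$; (2) if $(n,n')$ is $C$-below $(\rho,\rho')$ then $qn\not\preceq q'n'$; (3) $\rho,\rho'\le C$.
   Context: A one-counter net (OCN) $(Q,\mathrm{Act},\delta)$ has $\delta\subseteq Q\times\mathrm{Act}\times\{-1,0,1\}\times Q$ and induces the LTS on $Q\times\mathbb N$ with $pm\xrightarrow{a}qn$ iff $(p,a,d,q)\in\delta$ and $n=m+d\ge0$. $\preceq$ denotes strong simulation preorder on the disjoint union of the two LTSs (the largest relation $R$ such that for $(c,c')\in R$ and $c\xrightarrow{a}d$ there is $c'\xrightarrow{a}d'$ with $(d,d')\in R$). Normal form: $\mathcal N$ is non-blocking (every state has an outgoing transition with counter effect in $\{0,1\}$) and $\mathcal N'$ is complete (every state has an outgoing transition for every action). The product graph of $\mathcal N=(Q,\mathrm{Act},\delta)$ and $\mathcal N'=(Q',\mathrm{Act},\delta')$ has nodes $Q\times Q'$ and an edge from $(p,p')$ to $(q,q')$ for each pair of transitions $t=(p,a,d,q)\in\delta$, $t'=(p',a,d',q')\in\delta'$ with the same label; the length of a path is its number of edges, and a path is acyclic if it visits no node twice. A vector $(\rho,\rho')\in\mathbb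 R^2$ is positive if $\rho\ge0$, $\rho'\ge0$ and $(\rho,\rho')\ne(0,0)$. For a positive vector $(\rho,\rho')$ and $c\in\mathbb R$, a point $(n,n')\in\mathbb Z^2$ is $c$-above $(\rho,\rho')$ if there is a real $r\ge0$ with $n<r\rho-c$ and $n'>r\rho'+c$, and $c$-below $(\rho,\rho')$ if there is a real $r\ge 0$ with $n>r\rho+c$ and $n'<r\rho'-c$. *)

theory Defs
  imports Complex_Main "Graph_Theory.Arc_Walk"
begin

record ('q, 'a) ocn =
  states :: "'q set"
  acts :: "'a set"
  transitions :: "('q \<times> 'a \<times> int \<times> 'q) set"

definition one_counter_net :: "('q, 'a) ocn \<Rightarrow> bool" where
  "one_counter_net N \<longleftrightarrow>
     finite (states N) \<and> transitions N \<subseteq> states N \<times> acts N \<times> {-1, 0, 1} \<times> states N"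

definition non_blocking :: "('q, 'a) ocn \<Rightarrow> bool" where
  "non_blocking N \<longleftrightarrow>
     (\<forall>p\<in>states N. \<exists>a d q. (p, a, d, q) \<in> transitions N \<and> d \<in> {0, 1})"

definition complete_net :: "('q, 'a) ocn \<Rightarrow> bool" where
  "complete_net N \<longleftrightarrow>
     (\<forall>p\<in>states N. \<forall>a\<in>acts N. \<exists>d q. (p, a, d, q) \<in> transitions N)"

definition normal_form :: "('q, 'a) ocn \<Rightarrow> ('p, 'a) ocn \<Rightarrow> bool" where
  "normal_form N N' \<longleftrightarrow> non_blocking N \<and> complete_net N'"

type_synonym ('c, 'a) lts = "'c \<Rightarrow> 'a \<Rightarrow> 'c \<Rightarrow> bool"

definition ocn_lts :: "('q, 'a) ocn \<Rightarrow> ('q \<times> nat, 'a) lts" where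
  "ocn_lts N c a c' \<longleftrightarrow>
     (\<exists>d. (fst c, a, d, fst c') \<in> transitions N \<and> int (snd c') = int (snd c) + d)"

inductive lts_union :: "('c, 'a) lts \<Rightarrow> ('d, 'a) lts \<Rightarrow> ('c + 'd, 'a) lts"
  for T :: "('c, 'a) lts" and T' :: "('d, 'a) lts" where
  left: "T c a d \<Longrightarrow> lts_union T T' (Inl c) a (Inl d)"
| right: "T' c a d \<Longrightarrow> lts_union T T' (Inr c) a (Inr d)"

coinductive sim_preorder :: "('c, 'a) lts \<Rightarrow> 'c \<Rightarrow> 'c \<Rightarrow> bool"
  for T :: "('c, 'a) lts" where
  "(\<And>a d. T c a d \<Longrightarrow> \<exists>d'. T c' a d' \<and> sim_preorder T d d') \<Longrightarrow> sim_preorder T c c'"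

definition ocn_simulated ::
  "('q, 'a) ocn \<Rightarrow> ('p, 'a) ocn \<Rightarrow> 'q \<times> nat \<Rightarrow> 'p \<times> nat \<Rightarrow> bool" where
  "ocn_simulated N N' c c' \<longleftrightarrow>
     sim_preorder (lts_union (ocn_lts N) (ocn_lts N')) (Inl c) (Inr c')"

definition product_graph ::
  "('q, 'a) ocn \<Rightarrow> ('p, 'a) ocn \<Rightarrow>
    ('q \<times> 'p, ('q \<times> 'a \<times> int \<times> 'q) \<times> ('p \<times> 'a \<times> int \<times> 'p)) pre_digraph" where
  "product_graph N N' =
     \<lparr> verts = states N \<times> states N',
       arcs = {((p, a, d, q), (p', a', d', q')) | p a d q p' a' d' q'.
                 (p, a, d, q) \<in> transitions N \<and> (p', a', d', q') \<in> transitions N' \<and> a = a'},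
       tail = (\<lambda>((p, a, d, q), (p', a', d', q')). (p, p')),
       head = (\<lambda>((p, a, d, q), (p', a', d', q')). (q, q')) \<rparr>"

definition max_acyclic_path_length :: "('v, 'e) pre_digraph \<Rightarrow> nat" where
  "max_acyclic_path_length G = Max {length es | u es v. pre_digraph.apath G u es v}"

definition belt_width :: "('q, 'a) ocn \<Rightarrow> ('p, 'a) ocn \<Rightarrow> nat" where
  "belt_width N N' = 1 + max_acyclic_path_length (product_graph N N')"

definition positive_vector :: "real \<times> real \<Rightarrow> bool" where
  "positive_vector v \<longleftrightarrow> fst v \<ge> 0 \<and> snd v \<ge> 0 \<and> v \<noteq> (0, 0)"

definition c_above :: "real \<Rightarrow> real \<times> real \<Rightarrow> int \<times> int \<Rightarrow> bool" where
  "c_above c v x \<longleftrightarrow>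
     (\<exists>r\<ge>0. real_of_int (fst x) < r * fst v - c \<and> real_of_int (snd x) > r * snd v + c)"

definition c_below :: "real \<Rightarrow> real \<times> real \<Rightarrow> int \<times> int \<Rightarrow> bool" where
  "c_below c v x \<longleftrightarrow>
     (\<exists>r\<ge>0. real_of_int (fst x) > r * fst v + c \<and> real_of_int (snd x) < r * snd v - c)"

end

theory Submission
  imports Defs "HOL-Library.Product_Plus" "HOL-Library.Sublist"
begin

text \<open>
  Both players follow strategies that depend only on an acyclic path of the product graph: when a
  step closes a cycle, the cycle is cut off and its effect is added to a base point, from which the
  current point differs by less than the belt width \<open>C\<close> in each coordinate.

  Fix a direction \<open>v\<close>. If Spoiler can force each cycle closed to have an effect \<open>x\<close> strictly
  below \<open>v\<close>, the base point drifts away from \<open>v\<close>. If infinitely many cycles were closed, the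
  steepest positive effect \<open>x\<close> closed infinitely often would be followed arbitrarily far out,
  at bounded distance above its line; so it suffices that Spoiler also wins near \<open>x\<close> far out
  at the node where the cycle is closed. Otherwise Duplicator can prevent such cycles, and keeps the
  base point above \<open>v\<close>, provided he changes to the flattest slope that is still good for him
  whenever he enters a new node.

  The slope sought at a node is the flattest one at which Spoiler does not win far out; the belt
  below it is obtained by playing with the mediant of this slope and the next flatter one among the
  finitely many possible slopes of simple cycles.
\<close>

section \<open>Vectors in the plane\<close>

text \<open>Sign convention: the first coordinate is Spoiler's counter, the second Duplicator's. A
  positive value puts \<open>x\<close> above the line of direction \<open>v\<close>, on Duplicator's
  side; a negative value puts it below.\<close>

definition cross :: "int \<times> int \<Rightarrow> int \<times> int \<Rightarrow> int" where
  "cross v x = fst v * snd x - snd v * fst x"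

lemma cross_add_right: "cross v (x + y) = cross v x + cross v y"
  by (simp add: cross_def algebra_simps)

lemma cross_add_left: "cross (v + w) x = cross v x + cross w x"
  by (simp add: cross_def algebra_simps)

lemma cross_uminus_right: "cross v (- x) = - cross v x"
  by (simp add: cross_def)

definition pos_vec :: "int \<times> int \<Rightarrow> bool" where
  "pos_vec v \<longleftrightarrow> 0 \<le> fst v \<and> 0 \<le> snd v \<and> v \<noteq> (0, 0)"

lemma pos_vec_sum_pos: "pos_vec v \<Longrightarrow> 0 < fst v + snd v"
  by (cases v) (auto simp: pos_vec_def)

lemma pos_vec_add: "pos_vec v \<Longrightarrow> pos_vec w \<Longrightarrow> pos_vec (v + w)"
  by (cases v; cases w) (auto simp: pos_vec_def)

text \<open>Dividing by the coordinate sum instead of the first coordinate gives the vertical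
  direction a finite value too.\<close>

definition steepness :: "int \<times> int \<Rightarrow> real" where
  "steepness v = real_of_int (snd v) / real_of_int (fst v + snd v)"

lemma steepness_less_iff:
  assumes "pos_vec v" "pos_vec w"
  shows "steepness w < steepness v \<longleftrightarrow> cross v w < 0"
proof -
  have p: "0 < real_of_int (fst v + snd v)" "0 < real_of_int (fst w + snd w)"
    using assms pos_vec_sum_pos by (simp_all only: of_int_0_less_iff)
  have "steepness w < steepness v \<longleftrightarrow>
      real_of_int (snd w) * real_of_int (fst v + snd v) < real_of_int (snd v) * real_of_int (fst w + snd w)"
    unfolding steepness_def using p by (simp only: divide_less_eq less_divide_eq if_True times_divide_eq_left)
  also have "\<dots> \<longleftrightarrow> snd w * (fst v + snd v) < snd v * (fst w + snd w)"
    by (simp only: of_int_mult[symmetric] of_int_less_iff)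
  also have "\<dots> \<longleftrightarrow> cross v w < 0"
    by (simp add: cross_def algebra_simps)
  finally show ?thesis .
qed

lemma steepness_le_iff:
  assumes "pos_vec v" "pos_vec w"
  shows "steepness w \<le> steepness v \<longleftrightarrow> cross v w \<le> 0"
  using steepness_less_iff[OF assms(2,1)] by (simp add: cross_def mult.commute not_less[symmetric])

lemma cross_less_trans:
  assumes "pos_vec u" "pos_vec v" "pos_vec w" "cross u v < 0" "cross v w < 0"
  shows "cross u w < 0"
  using assms by (simp flip: steepness_less_iff)

lemma snd_neg_if_below:
  assumes "pos_vec v" "cross v x < 0" "\<not> pos_vec x"
  shows "snd x < 0"
proof (rule ccontr)
  assume "\<not> snd x < 0"
  then have "0 \<le> fst v * snd x" using assms(1) by (simp add: pos_vec_def)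
  then have "0 < snd v * fst x" using assms(2) by (simp add: cross_def)
  then have "0 < fst x" using assms(1) by (simp add: pos_vec_def zero_less_mult_iff)
  then show False using assms(3) \<open>\<not> snd x < 0\<close> by (auto simp: pos_vec_def)
qed

text \<open>Turning \<open>v\<close> down to the flatter positive \<open>w\<close> removes from the
  half-plane below \<open>v\<close> only directions in the positive quadrant, and \<open>x\<close>
  is not one of those.\<close>

lemma cross_nonpos_if_below:
  assumes "pos_vec v" "pos_vec w" "cross v w < 0" "cross v x < 0" "\<not> pos_vec x"
  shows "cross w x \<le> 0"
proof -
  obtain a b c d i j where vecs: "v = (a, b)" "w = (c, d)" "x = (i, j)"
    by (cases v; cases w; cases x)
  have j: "j < 0" using snd_neg_if_below[OF assms(1,4,5)] vecs by simp
  have nn: "0 \<le> a" "0 \<le> b" "0 \<le> c" "0 \<le> d" and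
    l: "a * d < b * c" "a * j < b * i"
    using assms vecs by (auto simp: pos_vec_def cross_def)
  have "c * j \<le> d * i"
  proof (cases "0 \<le> i")
    case True
    then have "c * j \<le> 0" "0 \<le> d * i" using nn j by (simp_all add: mult_nonneg_nonpos)
    then show ?thesis by linarith
  next
    case False
    then have "b * i \<le> 0" using nn by (simp add: mult_nonneg_nonpos)
    then have "a * j < 0" using l by linarith
    then have a: "0 < a" using j by (simp add: mult_less_0_iff)
    have "a * (c * j) \<le> c * (b * i)"
      using mult_left_mono[of "a * j" "b * i" c] l nn by (simp add: mult.left_commute)
    also have "\<dots> = (b * c) * i" by simp
    also have "\<dots> \<le> (a * d) * i" using l False by (intro mult_right_mono_neg) auto
    finally have "a * (c * j) \<le> a * (d * i)" by simp
    then show ?thesis using a by simp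
  qed
  then show ?thesis using vecs by (simp add: cross_def)
qed

text \<open>To the right of the vertical axis, lying above a line is a comparison of slopes, so it
  carries over from \<open>u\<close> to any positive direction that is no steeper.\<close>

lemma above_less_steep:
  assumes "pos_vec u" "pos_vec w" "cross u w \<le> 0" "0 < cross u x" "0 < fst x"
  shows "0 < cross w x"
proof -
  obtain a b c d i j where vecs: "u = (a, b)" "w = (c, d)" "x = (i, j)"
    by (cases u; cases w; cases x)
  have nn: "0 \<le> a" "0 \<le> b" "0 \<le> c" "0 \<le> d" "(c, d) \<noteq> (0, 0)" and
    l: "a * d \<le> b * c" "b * i < a * j" "0 < i"
    using assms vecs by (auto simp: pos_vec_def cross_def)
  have "0 \<le> b * i" using nn l by simp
  then have "0 < a * j" using l by linarith
  then have a: "0 < a" using nn by (simp add: zero_less_mult_iff)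
  have c: "0 < c"
  proof (rule ccontr)
    assume "\<not> 0 < c"
    then have "c = 0" "0 < d" using nn by auto
    moreover from this have "0 < a * d" using a by simp
    ultimately show False using l by simp
  qed
  have "a * (d * i) \<le> (b * c) * i" using mult_right_mono[OF l(1), of i] l by (simp add: mult.assoc)
  also have "\<dots> = c * (b * i)" by simp
  also have "\<dots> < c * (a * j)" using l(2) c by simp
  finally have "a * (d * i) < a * (c * j)" by (simp add: mult.left_commute)
  then have "d * i < c * j" using a by simp
  then show ?thesis using vecs by (simp add: cross_def)
qed

text \<open>Cramer's rule: a positive multiple of \<open>x\<close> is a nonnegative combination of
  \<open>u\<close> and \<open>w\<close>.\<close>

lemma pos_vec_between:
  assumes "pos_vec u" "pos_vec w" "cross w u < 0" "0 < cross u x" "cross w x < 0"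
  shows "pos_vec x"
proof -
  obtain a b c d i j where vecs: "u = (a, b)" "w = (c, d)" "x = (i, j)"
    by (cases u; cases w; cases x)
  have nn: "0 \<le> a" "0 \<le> b" "0 \<le> c" "0 \<le> d" and
    l: "0 < a * d - b * c" "0 < a * j - b * i" "0 < d * i - c * j"
    using assms vecs by (auto simp: pos_vec_def cross_def algebra_simps)
  have "(a * d - b * c) * i = (d * i - c * j) * a + (a * j - b * i) * c"
    by (simp add: algebra_simps)
  also have "\<dots> \<ge> 0" using nn l by (intro add_nonneg_nonneg mult_nonneg_nonneg) auto
  finally have i: "0 \<le> i" using l(1) by (simp add: zero_le_mult_iff)
  have "(a * d - b * c) * j = (d * i - c * j) * b + (a * j - b * i) * d"
    by (simp add: algebra_simps)
  also have "\<dots> \<ge> 0" using nn l by (intro add_nonneg_nonneg mult_nonneg_nonneg) auto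
  finally have j: "0 \<le> j" using l(1) by (simp add: zero_le_mult_iff)
  show ?thesis using i j l vecs by (auto simp: pos_vec_def)
qed

section \<open>Extremal slopes and bounded vectors\<close>

lemma ex_flattest:
  assumes "finite A" "A \<noteq> {}"
  shows "\<exists>x\<in>A. \<forall>y\<in>A. steepness x \<le> steepness y"
  using ex_is_arg_min_if_finite[OF assms, of steepness]
  unfolding is_arg_min_linorder by blast

lemma ex_steepest:
  assumes "finite A" "A \<noteq> {}"
  shows "\<exists>x\<in>A. \<forall>y\<in>A. steepness y \<le> steepness x"
  using ex_is_arg_min_if_finite[OF assms, of "\<lambda>x. - steepness x"]
  unfolding is_arg_min_linorder neg_le_iff_le by blast

definition bounded_by :: "int \<Rightarrow> int \<times> int \<Rightarrow> bool" where
  "bounded_by c x \<longleftrightarrow> \<bar>fst x\<bar> \<le> c \<and> \<bar>snd x\<bar> \<le> c"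

lemma bounded_by_add: "bounded_by c x \<Longrightarrow> bounded_by d y \<Longrightarrow> bounded_by (c + d) (x + y)"
  by (auto simp: bounded_by_def)

lemma finite_bounded_by: "finite {x. bounded_by c x}"
proof -
  have "{x. bounded_by c x} \<subseteq> {-c..c} \<times> {-c..c}" by (auto simp: bounded_by_def)
  then show ?thesis by (rule finite_subset) simp
qed

lemma abs_cross_le:
  assumes "pos_vec v" "bounded_by c x"
  shows "\<bar>cross v x\<bar> \<le> (fst v + snd v) * c"
proof -
  have "\<bar>cross v x\<bar> \<le> fst v * \<bar>snd x\<bar> + snd v * \<bar>fst x\<bar>"
    using assms(1) abs_triangle_ineq4[of "fst v * snd x" "snd v * fst x"]
    by (simp add: cross_def abs_mult pos_vec_def)
  also have "\<dots> \<le> fst v * c + snd v * c"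
    using assms by (intro add_mono mult_left_mono) (auto simp: bounded_by_def pos_vec_def)
  finally show ?thesis by (simp add: algebra_simps)
qed

text \<open>Over the integers \<open>cross v\<close> drops by at least 1 per step. As the second
  coordinate is bounded from below, only growth of the first one can pay for this.\<close>

lemma drifting_below_fst_unbounded:
  fixes b :: "nat \<Rightarrow> int \<times> int"
  assumes v: "pos_vec v"
    and below: "\<And>n. cross v (b (Suc n) - b n) < 0"
    and alive: "\<And>n. - c < snd (b n)"
  shows "\<exists>k. \<forall>n\<ge>k. m \<le> fst (b n)"
proof -
  have dec: "cross v (b n) \<le> cross v (b 0) - int n" for n
  proof (induction n)
    case (Suc n)
    have "cross v (b (Suc n)) = cross v (b n) + cross v (b (Suc n) - b n)"
      by (simp add: cross_def algebra_simps)
    then show ?case using Suc below[of n] by simp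
  qed simp
  have main: "m \<le> fst (b n)" if n: "int n > cross v (b 0) + fst v * c + snd v * \<bar>m\<bar>" for n
  proof -
    have "fst v * (- c) \<le> fst v * snd (b n)"
      using v alive[of n] by (intro mult_left_mono) (auto simp: pos_vec_def)
    then have "snd v * fst (b n) \<ge> - fst v * c - cross v (b n)"
      by (simp add: cross_def)
    then have *: "snd v * \<bar>m\<bar> < snd v * fst (b n)"
      using dec[of n] n by simp
    then have "\<bar>m\<bar> < fst (b n)"
      using v by (auto simp: pos_vec_def dest: mult_less_cancel_left_disj[THEN iffD1])
    then show ?thesis by linarith
  qed
  show ?thesis
    by (rule exI[of _ "nat (cross v (b 0) + fst v * c + snd v * \<bar>m\<bar>) + 1"]) (auto intro!: main)
qed

text \<open>The witness \<open>x\<close> is the steepest positive step that occurs infinitely often: from some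
  time on no step leads away from it on the upper side.\<close>

lemma drifting_below_recurrent_step:
  fixes b :: "nat \<Rightarrow> int \<times> int" and z :: "nat \<Rightarrow> 'z"
  assumes v: "pos_vec v"
    and below: "\<And>n. cross v (b (Suc n) - b n) < 0"
    and bounded: "\<And>n. bounded_by c (b (Suc n) - b n)"
    and alive: "\<And>n. - c < snd (b n)"
    and fin: "finite Z" "\<And>n. z n \<in> Z"
  shows "\<exists>x y k. pos_vec x \<and>
    (\<forall>m. \<exists>n. b (Suc n) - b n = x \<and> z n = y \<and> m \<le> fst (b (Suc n)) \<and> cross x (b (Suc n)) \<le> k)"
proof -
  define A where "A n = b (Suc n) - b n" for n
  define K where "K = {x. bounded_by c x \<and> (\<exists>\<^sub>F n in sequentially. A n = x)}"
  \<comment> \<open>Only finitely many step values are possible, so from some time on only those in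
    \<open>K\<close>, which recur forever, are taken.\<close>
  have "\<forall>\<^sub>F n in sequentially. \<forall>x\<in>{x. bounded_by c x} - K. A n \<noteq> x"
    using finite_bounded_by by (intro eventually_ball_finite) (auto simp: K_def not_frequently)
  then have "\<forall>\<^sub>F n in sequentially. A n \<in> K"
  proof (rule eventually_mono)
    show "A n \<in> K" if "\<forall>x\<in>{x. bounded_by c x} - K. A n \<noteq> x" for n
      using that bounded[of n] unfolding A_def by blast
  qed
  then obtain T where T: "\<And>n. T \<le> n \<Longrightarrow> A n \<in> K"
    unfolding eventually_sequentially by blast
  have finK: "finite K" unfolding K_def by (rule finite_subset[OF _ finite_bounded_by[of c]]) blast
  \<comment> \<open>Otherwise every late step lowers the second coordinate, which is bounded from
    below.\<close>
  have "\<exists>x\<in>K. pos_vec x"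
  proof (rule ccontr)
    assume none: "\<not> (\<exists>x\<in>K. pos_vec x)"
    have "snd (b (T + k)) \<le> snd (b T) - int k" for k
    proof (induction k)
      case (Suc k)
      have "snd (A (T + k)) < 0"
        using none T[of "T + k"] below[of "T + k"] snd_neg_if_below[OF v, of "A (T + k)"]
        by (auto simp: A_def)
      then show ?case using Suc by (simp add: A_def)
    qed simp
    from this[of "nat (snd (b T) + c)"] alive[of "T + nat (snd (b T) + c)"] alive[of T]
    show False by simp
  qed
  then have "{x \<in> K. pos_vec x} \<noteq> {}" by blast
  then obtain x where x: "x \<in> K" "pos_vec x"
    and steepest: "\<And>y. y \<in> K \<Longrightarrow> pos_vec y \<Longrightarrow> steepness y \<le> steepness x"
    using ex_steepest[of "{x \<in> K. pos_vec x}"] finK by fastforce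
  have "cross v x < 0"
    using x(1) below frequently_ex[of "\<lambda>n. A n = x"] unfolding K_def A_def by blast
  \<comment> \<open>Positive late steps are no steeper than \<open>x\<close>; the others lie below
    \<open>v\<close> outside the quadrant, hence not above \<open>x\<close> either.\<close>
  then have dec: "cross x (A n) \<le> 0" if "T \<le> n" for n
    using T[OF that] steepest[of "A n"] steepness_le_iff[OF x(2), of "A n"]
      cross_nonpos_if_below[OF v x(2), of "A n"] below[of n] unfolding A_def by blast
  have "cross x (b (T + k)) \<le> cross x (b T)" for k
  proof (induction k)
    case (Suc k)
    have "cross x (b (Suc (T + k))) = cross x (b (T + k)) + cross x (A (T + k))"
      by (simp add: A_def cross_def algebra_simps)
    then show ?case using Suc.IH dec[of "T + k"] by simp
  qed simp
  then have ub: "cross x (b n) \<le> cross x (b T)" if "T \<le> n" for n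
    using that by (auto simp: le_iff_add)
  have "\<exists>\<^sub>F n in sequentially. \<exists>y\<in>Z. A n = x \<and> z n = y"
    using x(1) fin(2) by (simp add: K_def)
  from frequently_bex_finite[OF fin(1) this]
  obtain y where y: "\<exists>\<^sub>F n in sequentially. A n = x \<and> z n = y" by blast
  have "\<exists>n. A n = x \<and> z n = y \<and> m \<le> fst (b (Suc n)) \<and> cross x (b (Suc n)) \<le> cross x (b T)" for m
  proof -
    obtain k where k: "\<And>n. k \<le> n \<Longrightarrow> m \<le> fst (b n)"
      using drifting_below_fst_unbounded[of v b c m, OF v below alive] by blast
    obtain n where "max k T \<le> n" "A n = x" "z n = y"
      using y unfolding frequently_sequentially by blast
    then show ?thesis using k[of "Suc n"] ub[of "Suc n"] by auto
  qed
  then show ?thesis using x(2) unfolding A_def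
    by (intro exI[of _ x] exI[of _ y] exI[of _ "cross x (b T)"]) simp
qed

section \<open>The first-cycle game\<close>

locale ocn_pair =
  fixes N :: "('q, 'a) ocn" and N' :: "('p, 'a) ocn"
  assumes net: "one_counter_net N" and net': "one_counter_net N'"
begin

abbreviation C :: int where
  "C \<equiv> int (belt_width N N')"

section \<open>Simulation on integer points\<close>

lemma transition_bounds:
  assumes "(p, a, d, q) \<in> transitions N" "(p', a, d', q') \<in> transitions N'"
  shows "(p, p') \<in> states N \<times> states N'" "(q, q') \<in> states N \<times> states N'" "bounded_by 1 (d, d')"
  using assms net net' by (auto simp: one_counter_net_def bounded_by_def)

text \<open>Integer coordinates allow vector arithmetic; a point outside the quadrant counts as not
  simulated, even when it is Spoiler's coordinate that is negative.\<close>

definition sim_at :: "'q \<times> 'p \<Rightarrow> int \<times> int \<Rightarrow> bool" where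
  "sim_at z x \<longleftrightarrow> 0 \<le> fst x \<and> 0 \<le> snd x \<and>
     ocn_simulated N N' (fst z, nat (fst x)) (snd z, nat (snd x))"

lemma sim_at_response:
  assumes "sim_at (p, p') x" "(p, a, d, q) \<in> transitions N" "0 \<le> fst x + d"
  shows "\<exists>d' q'. (p', a, d', q') \<in> transitions N' \<and> sim_at (q, q') (x + (d, d'))"
proof -
  let ?T = "lts_union (ocn_lts N) (ocn_lts N')"
  have x: "0 \<le> fst x" "0 \<le> snd x" using assms(1) by (auto simp: sim_at_def)
  have "?T (Inl (p, nat (fst x))) a (Inl (q, nat (fst x + d)))"
    using assms x by (intro lts_union.left) (auto simp: ocn_lts_def)
  moreover have "sim_preorder ?T (Inl (p, nat (fst x))) (Inr (p', nat (snd x)))"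
    using assms(1) by (simp add: sim_at_def ocn_simulated_def)
  ultimately obtain e where e: "?T (Inr (p', nat (snd x))) a e"
    "sim_preorder ?T (Inl (q, nat (fst x + d))) e"
    by (meson sim_preorder.cases)
  from e(1) obtain q' n' where e': "e = Inr (q', n')" "ocn_lts N' (p', nat (snd x)) a (q', n')"
    by (auto elim: lts_union.cases)
  then obtain d' where "(p', a, d', q') \<in> transitions N'" "int n' = snd x + d'"
    using x by (auto simp: ocn_lts_def)
  moreover from this have "sim_at (q, q') (x + (d, d'))"
    using e(2) e'(1) assms(3) by (simp add: sim_at_def ocn_simulated_def flip: \<open>int n' = snd x + d'\<close>)
  ultimately show ?thesis by blast
qed

lemma sim_at_coinduct:
  assumes R: "R z x"
    and nonneg: "\<And>z x. R z x \<Longrightarrow> 0 \<le> fst x \<and> 0 \<le> snd x"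
    and step: "\<And>p p' x a d q. R (p, p') x \<Longrightarrow> (p, a, d, q) \<in> transitions N \<Longrightarrow> 0 \<le> fst x + d \<Longrightarrow>
      \<exists>d' q'. (p', a, d', q') \<in> transitions N' \<and> R (q, q') (x + (d, d'))"
  shows "sim_at z x"
proof -
  let ?T = "lts_union (ocn_lts N) (ocn_lts N')"
  define X where "X c c' \<longleftrightarrow> (\<exists>p p' n n'. c = Inl (p, n) \<and> c' = Inr (p', n') \<and> R (p, p') (int n, int n'))"
    for c c' :: "'q \<times> nat + 'p \<times> nat"
  have "sim_preorder ?T c c'" if "X c c'" for c c'
    using that
  proof (coinduction arbitrary: c c')
    case sim_preorder
    then obtain p p' n n' where c: "c = Inl (p, n)" "c' = Inr (p', n')" "R (p, p') (int n, int n')"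
      by (auto simp: X_def)
    have "\<exists>d'. ?T c' a d' \<and> (X d d' \<or> sim_preorder ?T d d')" if "?T c a d" for a d
    proof -
      from that c obtain q k where d: "d = Inl (q, k)" "ocn_lts N (p, n) a (q, k)"
        by (auto elim: lts_union.cases)
      then obtain i where i: "(p, a, i, q) \<in> transitions N" "int k = int n + i"
        by (auto simp: ocn_lts_def)
      then obtain j q' where j: "(p', a, j, q') \<in> transitions N'" "R (q, q') (int n + i, int n' + j)"
        using step[OF c(3) i(1)] by auto
      have "0 \<le> int n' + j" using nonneg[OF j(2)] by simp
      then have "?T c' a (Inr (q', nat (int n' + j)))"
        using j c by (auto intro!: lts_union.right simp: ocn_lts_def)
      moreover have "X d (Inr (q', nat (int n' + j)))"
        using j(2) d i \<open>0 \<le> int n' + j\<close> by (auto simp: X_def)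
      ultimately show ?thesis by blast
    qed
    then show ?case by auto
  qed
  moreover have "X (Inl (fst z, nat (fst x))) (Inr (snd z, nat (snd x)))"
    using R nonneg[OF R] by (auto simp: X_def)
  ultimately show ?thesis
    using nonneg[OF R] by (auto simp: sim_at_def ocn_simulated_def)
qed

text \<open>An acyclic path of the product graph, most recent node first; each node carries the
  accumulated counter effect of the path leading to it.\<close>

inductive path_stack :: "(('q \<times> 'p) \<times> (int \<times> int)) list \<Rightarrow> bool" where
  single: "z \<in> states N \<times> states N' \<Longrightarrow> path_stack [(z, (0, 0))]"
| extend: "path_stack (((p, p'), e) # r) \<Longrightarrow> (p, a, d, q) \<in> transitions N \<Longrightarrow>
    (p', a, d', q') \<in> transitions N' \<Longrightarrow> (q, q') \<notin> fst ` set (((p, p'), e) # r) \<Longrightarrow>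
    path_stack (((q, q'), e + (d, d')) # ((p, p'), e) # r)"

lemma path_stack_nonempty: "path_stack s \<Longrightarrow> s \<noteq> []"
  by (auto elim: path_stack.cases)

lemma path_stack_nodes: "path_stack s \<Longrightarrow> fst ` set s \<subseteq> states N \<times> states N'"
  by (induction rule: path_stack.induct) (auto dest: transition_bounds(2))

lemma path_stack_suffix: "path_stack s \<Longrightarrow> suffix t s \<Longrightarrow> t \<noteq> [] \<Longrightarrow> path_stack t"
proof (induction arbitrary: t rule: path_stack.induct)
  case (single z)
  then have "t = [(z, (0, 0))]" by (auto simp: suffix_Cons)
  then show ?case using single by (auto intro: path_stack.single)
next
  case (extend p p' e r a d q d' q')
  show ?case
  proof (cases "t = ((q, q'), e + (d, d')) # ((p, p'), e) # r")
    case True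
    then show ?thesis using path_stack.extend[OF extend.hyps] by simp
  next
    case False
    then have "suffix t (((p, p'), e) # r)" using extend.prems by (auto simp: suffix_Cons)
    then show ?thesis using extend by blast
  qed
qed

lemma path_stack_last: "path_stack s \<Longrightarrow> snd (last s) = (0, 0)"
  by (induction rule: path_stack.induct) auto

lemma path_stack_effect:
  "path_stack s \<Longrightarrow> i < length s \<Longrightarrow> bounded_by (int i) (snd (hd s) - snd (s ! i))"
proof (induction arbitrary: i rule: path_stack.induct)
  case (single z)
  then show ?case by (simp add: bounded_by_def)
next
  case (extend p p' e r a d q d' q')
  show ?case
  proof (cases i)
    case 0
    then show ?thesis by (simp add: bounded_by_def)
  next
    case (Suc j)
    then have "bounded_by (int j) (e - snd ((((p, p'), e) # r) ! j))"
      using extend.IH[of j] extend.prems by simp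
    from bounded_by_add[OF this transition_bounds(3)[OF extend.hyps(2,3)]] show ?thesis
      using Suc by (simp add: bounded_by_def add_diff_eq diff_add_eq add.commute)
  qed
qed

section \<open>Stacks as acyclic paths of the product graph\<close>

abbreviation PG where "PG \<equiv> product_graph N N'"

lemma wf_product_graph: "wf_digraph PG"
  by unfold_locales (auto simp: product_graph_def dest: transition_bounds(1,2))

lemma path_stack_apath:
  "path_stack s \<Longrightarrow> \<exists>u es. pre_digraph.apath PG u es (fst (hd s)) \<and> length s = Suc (length es) \<and>
     pre_digraph.awalk_verts PG u es = rev (map fst s)"
proof (induction rule: path_stack.induct)
  case (single z)
  then show ?case
    by (intro exI[of _ z] exI[of _ "[]"])
      (simp add: pre_digraph.apath_def pre_digraph.awalk_def pre_digraph.cas.simps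
        pre_digraph.awalk_verts.simps product_graph_def)
next
  case (extend p p' e r a d q d' q')
  interpret wf_digraph PG by (rule wf_product_graph)
  from extend.IH obtain u es where es: "apath u es (p, p')" "length (((p, p'), e) # r) = Suc (length es)"
    "awalk_verts u es = rev (map fst (((p, p'), e) # r))" by auto
  let ?e = "((p, a, d, q), (p', a, d', q'))"
  have arc: "?e \<in> arcs PG" "tail PG ?e = (p, p')" "head PG ?e = (q, q')"
    using extend.hyps by (auto simp: product_graph_def)
  have walk: "awalk u (es @ [?e]) (q, q')"
    using awalk_appendI[of u es "(p, p')"] es(1) arc_implies_awalk[OF arc(1)]
    unfolding arc apath_def by blast
  have "awalk_verts u (es @ [?e]) = awalk_verts u es @ [(q, q')]"
  proof -
    have "cas u es (p, p')" using es(1) by (auto simp: apath_def awalk_def)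
    then show ?thesis using arc by (induction es arbitrary: u) auto
  qed
  moreover from this have "distinct (awalk_verts u (es @ [?e]))"
    using es extend.hyps(4) by (auto simp: apath_def)
  ultimately show ?case using walk es
    by (intro exI[of _ u] exI[of _ "es @ [?e]"]) (auto simp: apath_def)
qed

text \<open>The nodes of the path are distinct and outnumber its arcs by one. This makes the set
  under \<open>Max\<close> finite and bounds the belt width.\<close>

lemma apath_length_less:
  assumes "pre_digraph.apath PG u es v"
  shows "length es < card (states N \<times> states N')"
proof -
  interpret wf_digraph PG by (rule wf_product_graph)
  have w: "awalk u es v" "distinct (awalk_verts u es)" using assms by (auto simp: apath_def)
  have "Suc (length es) = card (set (awalk_verts u es))"
    using w by (simp add: distinct_card length_awalk_verts)
  also have "\<dots> \<le> card (states N \<times> states N')"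
  proof (rule card_mono)
    show "finite (states N \<times> states N')" using net net' by (simp add: one_counter_net_def)
    have "set (awalk_verts u es) \<subseteq> verts PG" using w(1) by auto
    then show "set (awalk_verts u es) \<subseteq> states N \<times> states N'" by (simp add: product_graph_def)
  qed
  finally show ?thesis by simp
qed

lemma apath_lengths_finite: "finite {length es | u es v. pre_digraph.apath PG u es v}"
  by (rule finite_subset[of _ "{..<card (states N \<times> states N')}"]) (auto dest: apath_length_less)

lemma belt_width_le_card:
  assumes "q \<in> states N" "q' \<in> states N'"
  shows "belt_width N N' \<le> card (states N \<times> states N')"
proof -
  have "pre_digraph.apath PG (q, q') [] (q, q')"
    using assms by (simp add: pre_digraph.apath_def pre_digraph.awalk_def pre_digraph.cas.simps
        pre_digraph.awalk_verts.simps product_graph_def)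
  then have "max_acyclic_path_length PG \<in> {length es | u es v. pre_digraph.apath PG u es v}"
    unfolding max_acyclic_path_length_def using apath_lengths_finite by (intro Max_in) blast+
  then show ?thesis using apath_length_less by (fastforce simp: belt_width_def)
qed

lemma path_stack_length:
  assumes "path_stack s"
  shows "int (length s) \<le> C"
proof -
  obtain u es v where es: "pre_digraph.apath PG u es v" "length s = Suc (length es)"
    using path_stack_apath[OF assms] by blast
  then have "length es \<le> max_acyclic_path_length PG"
    unfolding max_acyclic_path_length_def by (intro Max_ge apath_lengths_finite) blast
  then show ?thesis using es(2) by (simp add: belt_width_def)
qed

text \<open>At most \<open>C\<close> entries means at most \<open>C - 1\<close> edges above the
  bottom entry, whose effect is zero; each edge changes a coordinate by at most 1.\<close>

lemma path_stack_offset: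
  assumes "path_stack s"
  shows "bounded_by (C - 1) (snd (hd s))"
proof -
  have s: "s \<noteq> []" using assms by (rule path_stack_nonempty)
  have "bounded_by (int (length s - 1)) (snd (hd s) - snd (last s))"
    using path_stack_effect[OF assms, of "length s - 1"] s by (simp add: last_conv_nth)
  then show ?thesis using path_stack_last[OF assms] path_stack_length[OF assms] s
    by (cases s) (auto simp: bounded_by_def)
qed

section \<open>Closing a cycle\<close>

definition pop :: "'q \<times> 'p \<Rightarrow> (('q \<times> 'p) \<times> (int \<times> int)) list \<Rightarrow> (('q \<times> 'p) \<times> (int \<times> int)) list" where
  "pop z = dropWhile (\<lambda>e. fst e \<noteq> z)"

lemma pop_props:
  assumes "z \<in> fst ` set s"
  shows "suffix (pop z s) s" "pop z s \<noteq> []" "fst (hd (pop z s)) = z"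
proof -
  show "suffix (pop z s) s" by (simp add: pop_def suffix_dropWhile)
  show ne: "pop z s \<noteq> []" using assms by (auto simp: pop_def)
  show "fst (hd (pop z s)) = z" using hd_dropWhile[OF ne[unfolded pop_def]] by (simp add: pop_def)
qed

text \<open>The cycle consists of at most \<open>C - 1\<close> edges of the stack and the closing
  edge.\<close>

lemma cycle_effect_bounded:
  assumes s: "path_stack s" and z: "z \<in> fst ` set s" and d: "bounded_by 1 d"
  shows "bounded_by C (snd (hd s) + d - snd (hd (pop z s)))"
proof -
  let ?i = "length (takeWhile (\<lambda>e. fst e \<noteq> z) s)"
  have i: "?i < length s"
    using pop_props(2)[OF z] unfolding pop_def dropWhile_eq_drop by simp
  then have "hd (pop z s) = s ! ?i"
    by (simp add: pop_def dropWhile_eq_drop hd_drop_conv_nth)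
  then have "bounded_by (int ?i + 1) ((snd (hd s) - snd (hd (pop z s))) + d)"
    using path_stack_effect[OF s i] d bounded_by_add by metis
  then show ?thesis using i path_stack_length[OF s]
    by (auto simp: bounded_by_def)
qed

text \<open>Spoiler wins from every point that is far enough out and not too far above the line of
  direction \<open>v\<close>.\<close>

definition asym_win :: "'q \<times> 'p \<Rightarrow> int \<times> int \<Rightarrow> bool" where
  "asym_win z v \<longleftrightarrow> (\<forall>c. \<exists>m. \<forall>x. cross v x \<le> c \<longrightarrow> m \<le> fst x \<longrightarrow> \<not> sim_at z x)"

text \<open>Here \<open>x\<close> is the effect of the cycle and \<open>t\<close> the stack that remains when it is cut off.\<close>

definition good_cycle ::
  "int \<times> int \<Rightarrow> nat \<Rightarrow> (('q \<times> 'p) \<times> (int \<times> int)) list \<Rightarrow> int \<times> int \<Rightarrow> bool" where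
  "good_cycle v h t x \<longleftrightarrow>
     (if length t < h then asym_win (fst (hd t)) v
      else cross v x < 0 \<and> (pos_vec x \<longrightarrow> asym_win (fst (hd t)) x))"

text \<open>Spoiler can force that the first cycle closed from the stack is good for him. The bottom
  part of the stack, below height \<open>h\<close>, belongs to earlier phases played with other directions.\<close>

inductive phase_win :: "int \<times> int \<Rightarrow> nat \<Rightarrow> (('q \<times> 'p) \<times> (int \<times> int)) list \<Rightarrow> bool" for v h where
  move: "(p, a, d, q) \<in> transitions N \<Longrightarrow>
   (\<And>d' q'. (p', a, d', q') \<in> transitions N' \<Longrightarrow> (q, q') \<notin> fst ` set (((p, p'), e) # r) \<Longrightarrow>
     phase_win v h (((q, q'), e + (d, d')) # ((p, p'), e) # r)) \<Longrightarrow>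
   (\<And>d' q'. (p', a, d', q') \<in> transitions N' \<Longrightarrow> (q, q') \<in> fst ` set (((p, p'), e) # r) \<Longrightarrow>
     good_cycle v h (pop (q, q') (((p, p'), e) # r))
       (e + (d, d') - snd (hd (pop (q, q') (((p, p'), e) # r))))) \<Longrightarrow>
   phase_win v h (((p, p'), e) # r)"

section \<open>Spoiler\<close>

lemma stack_base_alive:
  assumes "path_stack s" "sim_at (fst (hd s)) (b + snd (hd s))"
  shows "- C < snd b"
  using path_stack_offset[OF assms(1)] assms(2) by (auto simp: sim_at_def bounded_by_def)

text \<open>Spoiler follows the moves given by \<open>phase_win\<close> against simulating responses
  until a cycle closes. The remaining stack satisfies the same invariant, so this can be
  iterated.\<close>

lemma spoiler_reaches_cycle:
  assumes "phase_win v h s" "path_stack s" "h \<le> length s"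
    and "\<forall>t. suffix t s \<longrightarrow> h \<le> length t \<longrightarrow> phase_win v h t"
    and "sim_at (fst (hd s)) (b + snd (hd s))"
    and big: "- C < snd b \<Longrightarrow> C \<le> fst b"
    and low: "\<And>z x. - C < snd b \<Longrightarrow> 1 < h \<Longrightarrow> z \<in> states N \<times> states N' \<Longrightarrow> bounded_by C x \<Longrightarrow>
      asym_win z v \<Longrightarrow> \<not> sim_at z (b + x)"
  shows "\<exists>s' x. path_stack s' \<and> h \<le> length s' \<and>
    (\<forall>t. suffix t s' \<longrightarrow> h \<le> length t \<longrightarrow> phase_win v h t) \<and>
    sim_at (fst (hd s')) (b + x + snd (hd s')) \<and> bounded_by C x \<and> cross v x < 0 \<and>
    (pos_vec x \<longrightarrow> asym_win (fst (hd s')) x)"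
  using assms(1-5)
proof (induction rule: phase_win.induct)
  case (move p a d q p' e r)
  let ?s = "((p, p'), e) # r"
  have off: "bounded_by (C - 1) e" using path_stack_offset[OF move.prems(1)] by simp
  have alive: "- C < snd b" using stack_base_alive[OF move.prems(1,4)] .
  have "- 1 \<le> d" using move.hyps(1) net by (auto simp: one_counter_net_def)
  \<comment> \<open>The base contributes at least \<open>C\<close>, the stack at least
    \<open>-(C - 1)\<close> and the move at least \<open>-1\<close>, so the move is enabled.\<close>
  then have "0 \<le> fst (b + e) + d" using big[OF alive] off by (auto simp: bounded_by_def)
  then obtain d' q' where t': "(p', a, d', q') \<in> transitions N'"
    and sim: "sim_at (q, q') (b + e + (d, d'))"
    using sim_at_response[of p p' "b + e" a d q] move.hyps(1) move.prems(4) by auto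
  note bnd = transition_bounds[OF move.hyps(1) t']
  show ?case
  proof (cases "(q, q') \<in> fst ` set ?s")
    case False
    let ?s' = "((q, q'), e + (d, d')) # ?s"
    have "phase_win v h ?s'" using move.hyps(2)[OF t' False] .
    moreover have "path_stack ?s'" using path_stack.extend[OF move.prems(1) move.hyps(1) t' False] .
    ultimately show ?thesis
      using move.IH[OF t' False] move.prems(2,3) sim by (simp add: suffix_Cons add.assoc)
  next
    case True
    let ?t = "pop (q, q') ?s" and ?x = "e + (d, d') - snd (hd (pop (q, q') ?s))"
    note pop = pop_props[OF True]
    have good: "good_cycle v h ?t ?x" using move.hyps(3)[OF t' True] .
    have "bounded_by C (e + (d, d'))" using bounded_by_add[OF off bnd(3)] by simp
    \<comment> \<open>If the cycle reached below height \<open>h\<close>, the node would be won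
      asymptotically and \<open>low\<close> would contradict \<open>sim\<close>. As a popped stack
      is nonempty, this case has \<open>1 < h\<close>.\<close>
    then have "h \<le> length ?t"
      using good low[of "(q, q')" "e + (d, d')"] alive sim bnd(2) pop(2,3)
      by (cases ?t) (auto simp: good_cycle_def add.assoc split: if_splits)
    moreover have "bounded_by C ?x" using cycle_effect_bounded[OF move.prems(1) True bnd(3)] by simp
    moreover have "path_stack ?t" using path_stack_suffix[OF move.prems(1) pop(1,2)] .
    moreover have "\<forall>t. suffix t ?t \<longrightarrow> h \<le> length t \<longrightarrow> phase_win v h t"
      using move.prems(3) pop(1) suffix_order.order_trans by blast
    moreover have "sim_at (fst (hd ?t)) (b + ?x + snd (hd ?t))"
      using sim pop(3) by (simp add: algebra_simps)
    ultimately show ?thesis using good unfolding good_cycle_def by (intro exI[of _ ?t] exI[of _ ?x]) auto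
  qed
qed

text \<open>\<open>Safe\<close> abstracts the region of the base points, so that one argument serves
  both far out and in the belt. If the simulation survived, closing cycles forever would make the
  base drift below \<open>v\<close>; an effect recurring at one node, far out near its own line,
  contradicts \<open>asym_win\<close> there.\<close>

lemma spoiler_wins_phase:
  assumes win: "phase_win v (length s) s" and s: "path_stack s" and v: "pos_vec v"
    and init: "Safe b"
    and step: "\<And>b x. Safe b \<Longrightarrow> bounded_by C x \<Longrightarrow> cross v x < 0 \<Longrightarrow> Safe (b + x)"
    and big: "\<And>b. Safe b \<Longrightarrow> - C < snd b \<Longrightarrow> C \<le> fst b"
    and low: "\<And>b z x. Safe b \<Longrightarrow> - C < snd b \<Longrightarrow> 1 < length s \<Longrightarrow> z \<in> states N \<times> states N' \<Longrightarrow>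
      bounded_by C x \<Longrightarrow> asym_win z v \<Longrightarrow> \<not> sim_at z (b + x)"
  shows "\<not> sim_at (fst (hd s)) (b + snd (hd s))"
proof
  assume sim: "sim_at (fst (hd s)) (b + snd (hd s))"
  define h where "h = length s"
  have h: "0 < h" using path_stack_nonempty[OF s] by (simp add: h_def)
  define P where "P sb \<longleftrightarrow> path_stack (fst sb) \<and> h \<le> length (fst sb) \<and>
    (\<forall>t. suffix t (fst sb) \<longrightarrow> h \<le> length t \<longrightarrow> phase_win v h t) \<and>
    sim_at (fst (hd (fst sb))) (snd sb + snd (hd (fst sb))) \<and> Safe (snd sb)" for sb
  define Q where "Q sb sb' \<longleftrightarrow> bounded_by C (snd sb' - snd sb) \<and> cross v (snd sb' - snd sb) < 0 \<and>
    (pos_vec (snd sb' - snd sb) \<longrightarrow> asym_win (fst (hd (fst sb'))) (snd sb' - snd sb))"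
    for sb sb' :: "(('q \<times> 'p) \<times> (int \<times> int)) list \<times> (int \<times> int)"
  have "\<forall>t. suffix t s \<longrightarrow> h \<le> length t \<longrightarrow> phase_win v h t"
    using win by (auto simp: h_def suffix_def)
  then have P0: "P (s, b)" using s sim init by (simp add: P_def h_def)
  have PS: "\<exists>sb'. P sb' \<and> Q sb sb'" if P: "P sb" for sb
  proof -
    have safe: "Safe (snd sb)" and "phase_win v h (fst sb)"
      using P by (auto simp: P_def)
    from spoiler_reaches_cycle[OF this(2), of "snd sb"] P big[OF safe] low[OF safe]
    obtain s' x where "path_stack s'" "h \<le> length s'"
      "\<forall>t. suffix t s' \<longrightarrow> h \<le> length t \<longrightarrow> phase_win v h t"
      "sim_at (fst (hd s')) (snd sb + x + snd (hd s'))" "bounded_by C x" "cross v x < 0"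
      "pos_vec x \<longrightarrow> asym_win (fst (hd s')) x"
      unfolding P_def h_def[symmetric] by auto
    then show ?thesis using step[OF safe, of x] by (intro exI[of _ "(s', snd sb + x)"]) (simp add: P_def Q_def)
  qed
  obtain f where f: "\<And>n. P (f n)" "\<And>n. Q (f n) (f (Suc n))"
    using dependent_nat_choice[of "\<lambda>_. P" "\<lambda>_. Q"] P0 PS by metis
  have Z: "finite (states N \<times> states N')" using net net' by (simp add: one_counter_net_def)
  have node: "fst (hd (fst (f n))) \<in> states N \<times> states N'" for n
  proof -
    have "path_stack (fst (f n))" using f(1)[of n] by (simp add: P_def)
    from path_stack_nodes[OF this] path_stack_nonempty[OF this] show ?thesis by auto
  qed
  have alive: "- C < snd (snd (f n))" for n
    using stack_base_alive[of "fst (f n)" "snd (f n)"] f(1)[of n] by (simp add: P_def)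
  obtain x y k where x: "pos_vec x" and
    rec: "\<And>m. \<exists>n. snd (f (Suc n)) - snd (f n) = x \<and> fst (hd (fst (f (Suc n)))) = y \<and>
      m \<le> fst (snd (f (Suc n))) \<and> cross x (snd (f (Suc n))) \<le> k"
    using drifting_below_recurrent_step[of v "\<lambda>n. snd (f n)" C "states N \<times> states N'"
        "\<lambda>n. fst (hd (fst (f (Suc n))))", OF v _ _ alive Z node] f(2)
    unfolding Q_def by blast
  have "asym_win y x" using rec[of 0] f(2) x unfolding Q_def by blast
  \<comment> \<open>The bound on \<open>cross x\<close> leaves room for the stack offset between
    base and current point.\<close>
  then obtain m where m: "\<And>i. cross x i \<le> k + (fst x + snd x) * C \<Longrightarrow> m \<le> fst i \<Longrightarrow> \<not> sim_at y i"
    unfolding asym_win_def by blast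
  obtain n where n: "fst (hd (fst (f (Suc n)))) = y" "m + C \<le> fst (snd (f (Suc n)))"
    "cross x (snd (f (Suc n))) \<le> k"
    using rec[of "m + C"] by blast
  let ?o = "snd (hd (fst (f (Suc n))))"
  have Pn: "path_stack (fst (f (Suc n)))" "sim_at y (snd (f (Suc n)) + ?o)"
    using f(1)[of "Suc n"] n(1) by (auto simp: P_def)
  have o: "bounded_by C ?o" using path_stack_offset[OF Pn(1)] by (simp add: bounded_by_def)
  have "\<not> sim_at y (snd (f (Suc n)) + ?o)"
  proof (rule m)
    show "cross x (snd (f (Suc n)) + ?o) \<le> k + (fst x + snd x) * C"
      using abs_cross_le[OF x o] n(3) by (simp add: cross_add_right)
    show "m \<le> fst (snd (f (Suc n)) + ?o)" using n(2) o by (simp add: bounded_by_def abs_le_iff)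
  qed
  then show False using Pn(2) by blast
qed

lemma phase_win_imp_asym_win:
  assumes win: "phase_win v (length s) s" and s: "path_stack s" and v: "pos_vec v"
  shows "asym_win (fst (hd s)) v"
  unfolding asym_win_def
proof
  fix c
  let ?Z = "states N \<times> states N'" and ?S = "(fst v + snd v) * C"
  define c0 where "c0 = c + ?S"
  have "\<forall>z. \<exists>m. asym_win z v \<longrightarrow> (\<forall>x. cross v x \<le> c0 + ?S \<longrightarrow> m \<le> fst x \<longrightarrow> \<not> sim_at z x)"
    unfolding asym_win_def by blast
  then obtain m where m: "\<And>z x. asym_win z v \<Longrightarrow> cross v x \<le> c0 + ?S \<Longrightarrow> m z \<le> fst x \<Longrightarrow> \<not> sim_at z x"
    by metis
  \<comment> \<open>\<open>M\<close> exceeds every threshold \<open>m z\<close> by at least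
    \<open>C\<close>, so a displacement bounded by \<open>C\<close> does not undercut it.\<close>
  define M where "M = (\<Sum>z\<in>?Z. \<bar>m z\<bar>) + C"
  have M: "m z + C \<le> M" if "z \<in> ?Z" for z
  proof -
    have "\<bar>m z\<bar> \<le> (\<Sum>z\<in>?Z. \<bar>m z\<bar>)"
      using net net' that by (intro member_le_sum) (auto simp: one_counter_net_def)
    then show ?thesis by (simp add: M_def)
  qed
  have CM: "C \<le> M" by (simp add: M_def sum_nonneg)
  \<comment> \<open>While Duplicator is alive, \<open>c0 - cross v b\<close> is at most
    \<open>c0 + fst v * C + snd v * fst b\<close>; \<open>R\<close> is chosen so that the bound in
    \<open>Safe\<close> then gives \<open>M \<le> fst b\<close>.\<close>
  define R where "R = (1 + C * snd v) * M + C * (c0 + fst v * C)"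
  \<comment> \<open>Every cycle lowers \<open>cross v\<close> by at least 1 and the first counter by at most \<open>C\<close>.\<close>
  define Safe where "Safe b \<longleftrightarrow> cross v b \<le> c0 \<and> R - C * (c0 - cross v b) \<le> fst b" for b
  have step: "Safe (b + x)" if "Safe b" "bounded_by C x" "cross v x < 0" for b x
  proof -
    have "C * 1 \<le> C * (- cross v x)" using that(3) by (intro mult_left_mono) auto
    moreover have "- C \<le> fst x" using that(2) by (simp add: bounded_by_def abs_le_iff)
    ultimately show ?thesis using that(1,3) by (simp add: Safe_def cross_add_right algebra_simps)
  qed
  have far: "M \<le> fst b" if "Safe b" "- C < snd b" for b
  proof -
    have "fst v * (- C) \<le> fst v * snd b" using that(2) v by (intro mult_left_mono) (auto simp: pos_vec_def)
    then have "c0 - cross v b \<le> c0 + fst v * C + snd v * fst b" by (simp add: cross_def)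
    then have "C * (c0 - cross v b) \<le> C * (c0 + fst v * C + snd v * fst b)"
      by (intro mult_left_mono) auto
    then have "(1 + C * snd v) * M \<le> (1 + C * snd v) * fst b"
      using that(1) by (simp add: Safe_def R_def algebra_simps)
    moreover have "0 < 1 + C * snd v" using v by (simp add: pos_vec_def add_pos_nonneg)
    ultimately show ?thesis by simp
  qed
  have low: "\<not> sim_at z (b + x)"
    if "Safe b" "- C < snd b" "z \<in> ?Z" "bounded_by C x" "asym_win z v" for b z x
  proof (rule m[OF that(5)])
    show "cross v (b + x) \<le> c0 + ?S"
      using that(1) abs_cross_le[OF v that(4)] by (simp add: Safe_def cross_add_right abs_le_iff)
    show "m z \<le> fst (b + x)" using far[OF that(1,2)] M[OF that(3)] that(4) by (simp add: bounded_by_def abs_le_iff)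
  qed
  have "\<not> sim_at (fst (hd s)) x" if x: "cross v x \<le> c" "R + C \<le> fst x" for x
  proof -
    let ?o = "snd (hd s)"
    have o: "bounded_by C ?o" using path_stack_offset[OF s] by (simp add: bounded_by_def)
    have b: "cross v (x - ?o) \<le> c0"
      using abs_cross_le[OF v o] x(1) by (simp add: c0_def cross_def algebra_simps)
    then have "0 \<le> C * (c0 - cross v (x - ?o))" by simp
    moreover have "R \<le> fst (x - ?o)" using x(2) o by (simp add: bounded_by_def abs_le_iff)
    ultimately have "Safe (x - ?o)" using b unfolding Safe_def by linarith
    from spoiler_wins_phase[OF win s v this step] far CM low show ?thesis
      by (force simp: order_trans)
  qed
  then show "\<exists>m. \<forall>x. cross v x \<le> c \<longrightarrow> m \<le> fst x \<longrightarrow> \<not> sim_at (fst (hd s)) x" by blast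
qed

text \<open>At height 1 no cycle reaches into an earlier phase. By \<open>sep\<close> every cycle
  below \<open>v\<close> keeps the base below the line of \<open>w\<close> shifted by the belt
  width, where Spoiler's counter is large enough as long as Duplicator is alive.\<close>

lemma spoiler_wins_below:
  assumes win: "phase_win v 1 [(z, (0, 0))]" and z: "z \<in> states N \<times> states N'"
    and v: "pos_vec v" and w: "pos_vec w"
    and sep: "\<And>x. bounded_by C x \<Longrightarrow> cross v x < 0 \<Longrightarrow> cross w x \<le> 0"
    and x: "cross w (x + (- C, C)) < 0"
  shows "\<not> sim_at z x"
proof -
  define Safe where "Safe b \<longleftrightarrow> cross w (b + (- C, C)) < 0" for b
  have big: "C \<le> fst b" if "Safe b" "- C < snd b" for b
  proof -
    have "0 \<le> fst w * (snd b + C)" using that(2) w by (simp add: pos_vec_def)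
    then have "0 < snd w * (fst b - C)" using that(1) by (simp add: Safe_def cross_def algebra_simps)
    then show ?thesis using w by (simp add: zero_less_mult_iff pos_vec_def)
  qed
  have "\<not> sim_at (fst (hd [(z, (0::int, 0::int))])) (x + snd (hd [(z, (0, 0))]))"
  proof (rule spoiler_wins_phase[where Safe = Safe, OF _ path_stack.single[OF z] v])
    show "Safe (b + x)" if "Safe b" "bounded_by C x" "cross v x < 0" for b x
      using that sep[OF that(2,3)] by (simp add: Safe_def cross_add_right)
  qed (use win x big in \<open>auto simp: Safe_def\<close>)
  then show ?thesis by (simp flip: zero_prod_def)
qed

section \<open>Duplicator\<close>

text \<open>A finite set containing every positive effect of a simple cycle; its bound yields
  \<open>\<rho>, \<rho>' \<le> C\<close>.\<close>

definition slopes :: "(int \<times> int) set" where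
  "slopes = {w. pos_vec w \<and> bounded_by C w}"

lemma finite_slopes: "finite slopes"
  unfolding slopes_def by (rule finite_subset[OF _ finite_bounded_by[of C]]) blast

text \<open>Duplicator keeps the base point \<open>b\<close> of the stack above \<open>u\<close>. Whenever the path enters a
  node at which Spoiler does not win asymptotically for some slope below the current \<open>v\<close>,
  Duplicator starts a new phase there, with the flattest such slope. Hence Spoiler wins
  asymptotically at every node of the stack for all slopes below \<open>v\<close>, and so a cycle that is not
  good for Spoiler neither reaches into an earlier phase nor has an effect below \<open>v\<close>.\<close>

definition dup_state ::
  "(('q \<times> 'p) \<times> (int \<times> int)) list \<Rightarrow> int \<times> int \<Rightarrow> int \<times> int \<Rightarrow> int \<times> int \<Rightarrow> nat \<Rightarrow> bool" where
  "dup_state s b v u h \<longleftrightarrow> path_stack s \<and> 0 < h \<and> h \<le> length s \<and> pos_vec v \<and> pos_vec u \<and>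
     (\<forall>x. bounded_by C x \<longrightarrow> 0 \<le> cross v x \<longrightarrow> 0 \<le> cross u x) \<and>
     0 < cross u (b + (C, - C)) \<and>
     (\<forall>t. suffix t s \<longrightarrow> t \<noteq> [] \<longrightarrow>
       (\<forall>w\<in>slopes. cross v w < 0 \<longrightarrow> asym_win (fst (hd t)) w) \<and>
       (length t < h \<longrightarrow> asym_win (fst (hd t)) v) \<and>
       (h \<le> length t \<longrightarrow> \<not> phase_win v h t))"

lemma dup_state_extend:
  assumes st: "dup_state s b v u h" and s': "path_stack (e # s)" and lose: "\<not> phase_win v h (e # s)"
    and alive: "0 \<le> fst (b + snd e)"
  shows "\<exists>v u h. dup_state (e # s) b v u h"
proof (cases "\<exists>w\<in>slopes. cross v w < 0 \<and> \<not> asym_win (fst e) w")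
  case False
  then have "dup_state (e # s) b v u h"
    using st s' lose by (auto simp: dup_state_def suffix_Cons)
  then show ?thesis by blast
next
  case True
  let ?W = "{w \<in> slopes. cross v w < 0 \<and> \<not> asym_win (fst e) w}"
  have v: "pos_vec v" and u: "pos_vec u" using st by (auto simp: dup_state_def)
  have "finite ?W" "?W \<noteq> {}" using finite_slopes True by auto
  from ex_flattest[OF this] obtain w where "w \<in> ?W" and flat: "\<And>y. y \<in> ?W \<Longrightarrow> steepness w \<le> steepness y"
    by blast
  then have w: "w \<in> slopes" "pos_vec w" "bounded_by C w" "cross v w < 0" "\<not> asym_win (fst e) w"
    by (auto simp: slopes_def)
  have trans: "cross v y < 0" if "y \<in> slopes" "cross w y < 0" for y
    using cross_less_trans[OF v w(2) _ w(4) that(2)] that(1) by (simp add: slopes_def)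
  have below: "asym_win (fst e) y" if "y \<in> slopes" "cross w y < 0" for y
  proof (rule ccontr)
    assume "\<not> asym_win (fst e) y"
    then have "steepness w \<le> steepness y" using flat that trans by blast
    then show False using that steepness_less_iff[OF w(2), of y] by (simp add: slopes_def)
  qed
  \<comment> \<open>\<open>-w\<close> is a bounded vector above \<open>v\<close>, hence not below
    \<open>u\<close>; so \<open>w\<close> is no steeper than \<open>u\<close>, and the shifted base,
    which has a positive first coordinate, stays above \<open>w\<close>.\<close>
  have "cross u w \<le> 0"
  proof -
    have "bounded_by C (- w)" "0 \<le> cross v (- w)"
      using w(3,4) by (auto simp: bounded_by_def cross_uminus_right)
    then have "0 \<le> cross u (- w)" using st unfolding dup_state_def by blast
    then show ?thesis by (simp add: cross_uminus_right)
  qed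
  moreover have "0 < fst (b + (C, - C))"
    using alive path_stack_offset[OF s'] by (auto simp: bounded_by_def)
  ultimately have base: "0 < cross w (b + (C, - C))"
    using above_less_steep[OF u w(2)] st by (simp add: dup_state_def)
  \<comment> \<open>Since Spoiler does not win asymptotically for \<open>w\<close> at this node, a
    phase of direction \<open>w\<close> started at the full height is lost for Spoiler.\<close>
  have lose': "\<not> phase_win w (length (e # s)) (e # s)"
    using phase_win_imp_asym_win[OF _ s' w(2)] w(5) by auto
  have old: "asym_win (fst (hd t)) y" if "suffix t s" "t \<noteq> []" "y \<in> slopes" "cross v y < 0" for t y
    using st that by (simp add: dup_state_def)
  have "(\<forall>y\<in>slopes. cross w y < 0 \<longrightarrow> asym_win (fst (hd t)) y) \<and>
       (length t < length (e # s) \<longrightarrow> asym_win (fst (hd t)) w) \<and>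
       (length (e # s) \<le> length t \<longrightarrow> \<not> phase_win w (length (e # s)) t)"
    if t: "suffix t (e # s)" "t \<noteq> []" for t
  proof (cases "t = e # s")
    case True
    then show ?thesis using below lose' by simp
  next
    case False
    then have "suffix t s" using t(1) by (simp add: suffix_Cons)
    then show ?thesis
      using old[OF _ t(2)] trans w(1,4) suffix_length_le[of t s] by auto
  qed
  then have "dup_state (e # s) b w w (length (e # s))"
    unfolding dup_state_def using s' w(2) base by simp
  then show ?thesis by blast
qed

text \<open>As \<open>phase_win\<close> fails, some response either extends the path to a stack
  still lost for Spoiler or closes a cycle that is not good; the effect of such a cycle does not
  lower \<open>cross u\<close>.\<close>

lemma dup_state_step:
  assumes st: "dup_state (((p, p'), e) # r) b v u h"
    and t: "(p, a, d, q) \<in> transitions N"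
    and n: "0 \<le> fst (b + e + (d, d0))"
  shows "\<exists>d' q' s b' v u h. (p', a, d', q') \<in> transitions N' \<and> dup_state s b' v u h \<and>
    fst (hd s) = (q, q') \<and> b' + snd (hd s) = b + e + (d, d')"
proof -
  let ?s = "((p, p'), e) # r"
  have s: "path_stack ?s" and h: "0 < h" "h \<le> length ?s" using st by (auto simp: dup_state_def)
  then have "\<not> phase_win v h ?s" using st by (auto simp: dup_state_def)
  then obtain d' q' where t': "(p', a, d', q') \<in> transitions N'" and
    resp: "(q, q') \<notin> fst ` set ?s \<and> \<not> phase_win v h (((q, q'), e + (d, d')) # ?s) \<or>
      (q, q') \<in> fst ` set ?s \<and>
      \<not> good_cycle v h (pop (q, q') ?s) (e + (d, d') - snd (hd (pop (q, q') ?s)))"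
    using phase_win.move[OF t, of p' e r v h] by blast
  from resp show ?thesis
  proof (elim disjE conjE)
    assume new: "(q, q') \<notin> fst ` set ?s" "\<not> phase_win v h (((q, q'), e + (d, d')) # ?s)"
    have "0 \<le> fst (b + snd ((q, q'), e + (d, d')))" using n by simp
    from dup_state_extend[OF st path_stack.extend[OF s t t' new(1)] new(2) this] t'
    obtain v u h where "dup_state (((q, q'), e + (d, d')) # ?s) b v u h" by blast
    with t' show ?thesis
      by (intro exI[of _ d'] exI[of _ q'] exI[of _ "((q, q'), e + (d, d')) # ?s"] exI[of _ b]
          exI[of _ v] exI[of _ u] exI[of _ h]) (simp add: add.assoc)
  next
    let ?t = "pop (q, q') ?s" and ?x = "e + (d, d') - snd (hd (pop (q, q') ?s))"
    assume old: "(q, q') \<in> fst ` set ?s" "\<not> good_cycle v h ?t ?x"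
    note pop = pop_props[OF old(1)]
    have bnd: "bounded_by C ?x"
      using cycle_effect_bounded[OF s old(1) transition_bounds(3)[OF t t']] by simp
    have inv: "(\<forall>w\<in>slopes. cross v w < 0 \<longrightarrow> asym_win (fst (hd ?t)) w) \<and>
       (length ?t < h \<longrightarrow> asym_win (fst (hd ?t)) v)"
      using st pop unfolding dup_state_def by blast
    have len: "h \<le> length ?t" using old(2) inv by (auto simp: good_cycle_def not_less[symmetric])
    \<comment> \<open>A cycle below \<open>v\<close> that is not good has a positive effect, hence a
      slope, for which the invariant gives Spoiler an asymptotic win at this node.\<close>
    have "0 \<le> cross v ?x"
    proof (rule ccontr)
      assume "\<not> 0 \<le> cross v ?x"
      then have neg: "cross v ?x < 0" by simp
      then have "pos_vec ?x" "\<not> asym_win (fst (hd ?t)) ?x"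
        using old(2) len unfolding good_cycle_def by (simp_all split: if_splits)
      moreover from this bnd have "?x \<in> slopes" unfolding slopes_def by blast
      ultimately show False using inv neg by blast
    qed
    then have "0 \<le> cross u ?x" using st bnd unfolding dup_state_def by blast
    then have "0 < cross u (b + ?x + (C, - C))"
      using st by (simp add: dup_state_def cross_add_right)
    moreover have "path_stack ?t" using path_stack_suffix[OF s pop(1,2)] .
    moreover have "suffix t' ?s" if "suffix t' ?t" for t'
      using suffix_order.order_trans[OF that pop(1)] .
    ultimately have "dup_state ?t (b + ?x) v u h"
      using st len unfolding dup_state_def by blast
    with t' pop(3) show ?thesis
      by (intro exI[of _ d'] exI[of _ q'] exI[of _ ?t] exI[of _ "b + ?x"]
          exI[of _ v] exI[of _ u] exI[of _ h]) (simp add: algebra_simps)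
  qed
qed

text \<open>The base is above the belt and right of \<open>-C\<close>, so its second coordinate
  exceeds \<open>C\<close>, and the offset takes away at most \<open>C - 1\<close>. The bound leaves
  room for Duplicator's next decrement.\<close>

lemma dup_state_snd:
  assumes "dup_state s b v u h" "0 \<le> fst (b + snd (hd s))"
  shows "1 < snd (b + snd (hd s))"
proof -
  have off: "bounded_by (C - 1) (snd (hd s))" and u: "pos_vec u" and c: "0 < cross u (b + (C, - C))"
    using assms(1) path_stack_offset by (auto simp: dup_state_def)
  have "0 \<le> snd u * (fst b + C)"
    using u off assms(2) by (intro mult_nonneg_nonneg) (auto simp: pos_vec_def bounded_by_def)
  then have "0 < fst u * (snd b - C)" using c by (simp add: cross_def)
  then have "C < snd b" using u by (simp add: zero_less_mult_iff pos_vec_def)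
  then show ?thesis using off by (auto simp: bounded_by_def)
qed

lemma dup_state_sim_at:
  assumes "dup_state s b v u h" "0 \<le> fst (b + snd (hd s))"
  shows "sim_at (fst (hd s)) (b + snd (hd s))"
proof -
  define R where "R z x \<longleftrightarrow> 0 \<le> fst x \<and> 0 \<le> snd x \<and>
    (\<exists>s b v u h. dup_state s b v u h \<and> z = fst (hd s) \<and> x = b + snd (hd s))" for z x
  show ?thesis
  proof (rule sim_at_coinduct[of R])
    show "R (fst (hd s)) (b + snd (hd s))"
      using assms dup_state_snd[OF assms] unfolding R_def
      by (intro conjI exI[of _ s] exI[of _ b] exI[of _ v] exI[of _ u] exI[of _ h]) auto
  next
    fix p p' x a d q
    assume R: "R (p, p') x" and t: "(p, a, d, q) \<in> transitions N" and n: "0 \<le> fst x + d"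
    then obtain s b v u h where st: "dup_state s b v u h" "(p, p') = fst (hd s)" "x = b + snd (hd s)"
      by (auto simp: R_def)
    moreover have "s \<noteq> []" using st(1) by (auto simp: dup_state_def)
    ultimately obtain e r where s: "s = ((p, p'), e) # r" "x = b + e" by (cases s) auto
    have "1 < snd x" using dup_state_snd[OF st(1)] R st(3) by (simp add: R_def)
    obtain d' q' s' b' v' u' h' where t': "(p', a, d', q') \<in> transitions N'" and
      st': "dup_state s' b' v' u' h'" "fst (hd s') = (q, q')" "b' + snd (hd s') = x + (d, d')"
      using dup_state_step[of p p' e r b v u h a d q 0] st(1) t n s by auto
    have "- 1 \<le> d'" using transition_bounds(3)[OF t t'] by (auto simp: bounded_by_def)
    then have "0 \<le> fst (x + (d, d')) \<and> 0 \<le> snd (x + (d, d'))" using n \<open>1 < snd x\<close> by simp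
    then have "R (q, q') (x + (d, d'))" unfolding R_def using st'
      by (intro conjI exI[of _ s'] exI[of _ b'] exI[of _ v'] exI[of _ u'] exI[of _ h']) auto
    then show "\<exists>d' q'. (p', a, d', q') \<in> transitions N' \<and> R (q, q') (x + (d, d'))"
      using t' by blast
  qed (simp add: R_def)
qed

text \<open>\<open>v\<close> directs the cycle game and \<open>u\<close> the belt; they differ when
  the mediant is played.\<close>

lemma duplicator_wins_above:
  assumes lose: "\<not> phase_win v 1 [(z, (0, 0))]" and z: "z \<in> states N \<times> states N'"
    and v: "pos_vec v" and u: "pos_vec u"
    and sep: "\<And>x. bounded_by C x \<Longrightarrow> 0 \<le> cross v x \<Longrightarrow> 0 \<le> cross u x"
    and flatter: "\<And>w. w \<in> slopes \<Longrightarrow> cross v w < 0 \<Longrightarrow> asym_win z w"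
    and x: "0 < cross u (x + (C, - C))" "0 \<le> fst x"
  shows "sim_at z x"
proof -
  have "dup_state [(z, (0, 0))] x v u 1"
    unfolding dup_state_def using lose path_stack.single[OF z] v u sep flatter x by (auto simp: suffix_Cons)
  from dup_state_sim_at[OF this] show ?thesis using x(2) by (simp flip: zero_prod_def)
qed

section \<open>The threshold slope\<close>

lemma C_pos: "1 \<le> C"
  by (simp add: belt_width_def)

text \<open>Otherwise \<open>-x\<close> would be a bounded positive vector strictly between the
  consecutive slopes \<open>u\<close> and \<open>w\<close>.\<close>

lemma no_vector_between:
  assumes w: "w \<in> slopes" and u: "u \<in> slopes" and less: "cross w u < 0"
    and consec: "\<And>y. y \<in> slopes \<Longrightarrow> cross w y < 0 \<Longrightarrow> cross u y \<le> 0"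
    and x: "bounded_by C x"
  shows "\<not> (cross u x < 0 \<and> 0 < cross w x)"
proof
  assume *: "cross u x < 0 \<and> 0 < cross w x"
  then have "pos_vec (- x)"
    using pos_vec_between[of u w "- x"] w u less by (simp add: slopes_def cross_uminus_right)
  moreover have "bounded_by C (- x)" using x by (simp add: bounded_by_def)
  ultimately show False using consec[of "- x"] * by (simp add: slopes_def cross_uminus_right)
qed

lemma threshold_slope:
  assumes z: "z \<in> states N \<times> states N'"
  shows "\<exists>w\<in>slopes. (\<forall>x. 0 \<le> fst x \<longrightarrow> 0 < cross w (x + (C, - C)) \<longrightarrow> sim_at z x) \<and>
    (\<forall>x. 0 \<le> snd x \<longrightarrow> cross w (x + (- C, C)) < 0 \<longrightarrow> \<not> sim_at z x)"
proof -
  let ?W = "{w \<in> slopes. \<not> asym_win z w \<or> fst w = 0}"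
  have vert: "(0, 1) \<in> slopes" and hor: "(1, 0) \<in> slopes"
    using C_pos by (auto simp: slopes_def pos_vec_def bounded_by_def)
  have "finite ?W" "?W \<noteq> {}" using finite_slopes vert by auto
  from ex_flattest[OF this] obtain w where wW: "w \<in> ?W" and flat: "\<And>y. y \<in> ?W \<Longrightarrow> steepness w \<le> steepness y"
    by blast
  then have w: "w \<in> slopes" "pos_vec w" by (auto simp: slopes_def)
  have below: "asym_win z y \<and> fst y \<noteq> 0" if "y \<in> slopes" "cross w y < 0" for y
  proof (rule ccontr)
    assume "\<not> (asym_win z y \<and> fst y \<noteq> 0)"
    then have "steepness w \<le> steepness y" using flat that by blast
    then show False using that steepness_less_iff[OF w(2), of y] by (simp add: slopes_def)
  qed
  have above: "sim_at z x" if x: "0 \<le> fst x" "0 < cross w (x + (C, - C))" for x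
  proof (cases "fst w = 0")
    case True
    then have "snd w * (fst x + C) < 0" using x(2) by (simp add: cross_def)
    moreover have "0 \<le> snd w * (fst x + C)" using x(1) w by (simp add: pos_vec_def)
    ultimately show ?thesis by simp
  next
    case False
    then have "\<not> asym_win z w" using wW by simp
    then have "\<not> phase_win w 1 [(z, (0, 0))]"
      using phase_win_imp_asym_win[OF _ path_stack.single[OF z] w(2)] by auto
    then show ?thesis
      using duplicator_wins_above[OF _ z w(2) w(2)] below x by blast
  qed
  have "\<not> sim_at z x" if x: "0 \<le> snd x" "cross w (x + (- C, C)) < 0" for x
  proof (cases "snd w = 0")
    case True
    then have "fst w * (snd x + C) < 0" using x(2) by (simp add: cross_def)
    moreover have "0 \<le> fst w * (snd x + C)" using x(1) w by (simp add: pos_vec_def)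
    ultimately show ?thesis by simp
  next
    case False
    let ?U = "{y \<in> slopes. cross w y < 0}"
    have "(1, 0) \<in> ?U" using hor False w(2) by (simp add: cross_def pos_vec_def)
    then have "finite ?U" "?U \<noteq> {}" using finite_slopes by auto
    from ex_steepest[OF this] obtain u where uU: "u \<in> ?U" and steep: "\<And>y. y \<in> ?U \<Longrightarrow> steepness y \<le> steepness u"
      by blast
    then have u: "u \<in> slopes" "pos_vec u" "cross w u < 0" by (auto simp: slopes_def)
    have "cross u y \<le> 0" if "y \<in> slopes" "cross w y < 0" for y
      using steep[of y] that steepness_le_iff[OF u(2), of y] by (simp add: slopes_def)
    then have gap: "\<not> (cross u i < 0 \<and> 0 < cross w i)" if "bounded_by C i" for i
      using no_vector_between[OF w(1) u(1,3) _ that] by blast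
    \<comment> \<open>The mediant lies strictly between the consecutive slopes \<open>u\<close> and \<open>w\<close>.\<close>
    let ?v = "u + w"
    have v: "pos_vec ?v" using u w pos_vec_add by blast
    \<comment> \<open>If Spoiler lost with the mediant, Duplicator would win above the belt of
      \<open>u\<close>, even far out, against \<open>asym_win z u\<close>.\<close>
    have "phase_win ?v 1 [(z, (0, 0))]"
    proof (rule ccontr)
      assume lose: "\<not> phase_win ?v 1 [(z, (0, 0))]"
      have dup: "sim_at z y" if y: "0 < cross u (y + (C, - C))" "0 \<le> fst y" for y
      proof (rule duplicator_wins_above[OF lose z v u(2) _ _ y])
        show "0 \<le> cross u i" if "bounded_by C i" "0 \<le> cross ?v i" for i
          using gap[OF that(1)] that(2) by (auto simp: cross_add_left)
        show "asym_win z i" if "i \<in> slopes" "cross ?v i < 0" for i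
        proof (cases "cross w i < 0")
          case True
          then show ?thesis using below that(1) by blast
        next
          case False
          then have "cross u i < 0" using that(2) by (simp add: cross_add_left)
          then have "cross w i < 0"
            using cross_less_trans[OF w(2) u(2) _ u(3)] that(1) by (simp add: slopes_def)
          then show ?thesis using False by simp
        qed
      qed
      have "asym_win z u" "fst u \<noteq> 0" using below u by auto
      then obtain m where m: "\<And>y. cross u y \<le> (fst u + snd u) * (C + 1) \<Longrightarrow> m \<le> fst y \<Longrightarrow> \<not> sim_at z y"
        unfolding asym_win_def by blast
      \<comment> \<open>The point \<open>y\<close> is shifted by \<open>C + 1\<close> from the line
        of \<open>u\<close>, just outside the belt; the multiple \<open>k\<close> of
        \<open>u\<close> takes it beyond \<open>m\<close>.\<close>
      define k where "k = \<bar>m\<bar> + C + 1"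
      define y where "y = (k * fst u - (C + 1), k * snd u + (C + 1))"
      have "1 \<le> fst u" using u(2) \<open>fst u \<noteq> 0\<close> by (simp add: pos_vec_def)
      then have "k * 1 \<le> k * fst u" by (intro mult_left_mono) (auto simp: k_def)
      moreover have "k - (C + 1) = \<bar>m\<bar>" by (simp add: k_def)
      ultimately have y1: "\<bar>m\<bar> \<le> fst y" unfolding y_def fst_conv by linarith
      have y2: "cross u y = (fst u + snd u) * (C + 1)" by (simp add: cross_def y_def algebra_simps)
      have "cross u (y + (C, - C)) = fst u + snd u" using y2 by (simp add: cross_def algebra_simps)
      then have "0 < cross u (y + (C, - C))" using pos_vec_sum_pos[OF u(2)] by simp
      then have "sim_at z y" using dup y1 by simp
      moreover have "\<not> sim_at z y" using m y1 y2 by simp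
      ultimately show False by blast
    qed
    \<comment> \<open>A vector above \<open>w\<close> but below the mediant would lie below
      \<open>u\<close>, which \<open>gap\<close> excludes.\<close>
    moreover have "cross w i \<le> 0" if "bounded_by C i" "cross ?v i < 0" for i
      using gap[OF that(1)] that(2) by (auto simp: cross_add_left)
    ultimately show ?thesis using spoiler_wins_below[OF _ z v w(2) _ x(2)] by blast
  qed
  with above w(1) show ?thesis by blast
qed

end

section \<open>From real multiples of the direction to integer inequalities\<close>

lemma c_above_cross:
  assumes "c_above (real C) (real \<rho>, real \<rho>') (int n, int n')" "0 < C"
  shows "0 < cross (int \<rho>, int \<rho>') ((int n, int n') + (int C, - int C))"
proof -
  obtain r where r: "0 \<le> r" "real n + real C < r * real \<rho>" "r * real \<rho>' < real n' - real C"
    using assms(1) by (auto simp: c_above_def)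
  \<comment> \<open>With \<open>\<rho> = 0\<close> the first inequality would give
    \<open>n + C < 0\<close>. Positivity keeps the second one strict under multiplication, which
    eliminates \<open>r\<close>.\<close>
  have "0 < real \<rho>"
    using r(1,2) assms(2) by (cases "\<rho> = 0") auto
  have "real \<rho>' * (real n + real C) \<le> real \<rho>' * (r * real \<rho>)"
    using r(2) by (intro mult_left_mono) auto
  also have "\<dots> = real \<rho> * (r * real \<rho>')" by simp
  also have "\<dots> < real \<rho> * (real n' - real C)"
    using r(3) \<open>0 < real \<rho>\<close> by (intro mult_strict_left_mono)
  finally have "real_of_int (int \<rho>' * (int n + int C)) < real_of_int (int \<rho> * (int n' - int C))"
    by simp
  then show ?thesis unfolding of_int_less_iff by (simp add: cross_def)
qed

lemma c_below_cross:
  assumes "c_below (real C) (real \<rho>, real \<rho>') (int n, int n')" "0 < C"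
  shows "cross (int \<rho>, int \<rho>') ((int n, int n') + (- int C, int C)) < 0"
proof -
  obtain r where r: "0 \<le> r" "r * real \<rho> < real n - real C" "real n' + real C < r * real \<rho>'"
    using assms(1) by (auto simp: c_below_def)
  have "0 < real \<rho>'"
    using r(1,3) assms(2) by (cases "\<rho>' = 0") auto
  have "real \<rho> * (real n' + real C) \<le> real \<rho> * (r * real \<rho>')"
    using r(3) by (intro mult_left_mono) auto
  also have "\<dots> = real \<rho>' * (r * real \<rho>)" by simp
  also have "\<dots> < real \<rho>' * (real n - real C)"
    using r(2) \<open>0 < real \<rho>'\<close> by (intro mult_strict_left_mono)
  finally have "real_of_int (int \<rho> * (int n' + int C)) < real_of_int (int \<rho>' * (int n - int C))"
    by simp
  then show ?thesis unfolding of_int_less_iff by (simp add: cross_def)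
qed

theorem theorem4p2:
  fixes N :: "('q, 'a) ocn" and N' :: "('p, 'a) ocn" and C :: nat
    and q :: 'q and q' :: 'p
  assumes "one_counter_net N" and "one_counter_net N'"
    and "acts N = acts N'"
    and "normal_form N N'"
    and "C = belt_width N N'"
    and "q \<in> states N" and "q' \<in> states N'"
  shows "C \<le> card (states N \<times> states N') \<and>
    (\<exists>\<rho> \<rho>' :: nat.
       positive_vector (real \<rho>, real \<rho>') \<and>
       (\<forall>n n' :: nat. c_above (real C) (real \<rho>, real \<rho>') (int n, int n') \<longrightarrow>
          ocn_simulated N N' (q, n) (q', n')) \<and>
       (\<forall>n n' :: nat. c_below (real C) (real \<rho>, real \<rho>') (int n, int n') \<longrightarrow>
          \<not> ocn_simulated N N' (q, n) (q', n')) \<and>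
       \<rho> \<le> C \<and> \<rho>' \<le> C)"
proof -
  interpret ocn_pair N N' using assms(1,2) by unfold_locales
  have C: "0 < C" using assms(5) by (simp add: belt_width_def)
  obtain w where w: "w \<in> slopes"
    and above: "\<And>x. 0 \<le> fst x \<Longrightarrow> 0 < cross w (x + (int C, - int C)) \<Longrightarrow> sim_at (q, q') x"
    and below: "\<And>x. 0 \<le> snd x \<Longrightarrow> cross w (x + (- int C, int C)) < 0 \<Longrightarrow> \<not> sim_at (q, q') x"
    using threshold_slope[of "(q, q')"] assms(5-7) by auto
  obtain \<rho> \<rho>' :: nat where \<rho>: "w = (int \<rho>, int \<rho>')" "(\<rho>, \<rho>') \<noteq> (0, 0)" "\<rho> \<le> C" "\<rho>' \<le> C"
  proof
    show "w = (int (nat (fst w)), int (nat (snd w)))" "(nat (fst w), nat (snd w)) \<noteq> (0, 0)"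
      "nat (fst w) \<le> C" "nat (snd w) \<le> C"
      using w assms(5) by (cases w; auto simp: slopes_def pos_vec_def bounded_by_def)+
  qed
  have sim: "sim_at (q, q') (int n, int n') \<longleftrightarrow> ocn_simulated N N' (q, n) (q', n')" for n n'
    by (simp add: sim_at_def)
  have "ocn_simulated N N' (q, n) (q', n')"
    if "c_above (real C) (real \<rho>, real \<rho>') (int n, int n')" for n n'
    using above[of "(int n, int n')"] c_above_cross[OF that C] unfolding sim \<rho>(1) by simp
  moreover have "\<not> ocn_simulated N N' (q, n) (q', n')"
    if "c_below (real C) (real \<rho>, real \<rho>') (int n, int n')" for n n'
    using below[of "(int n, int n')"] c_below_cross[OF that C] unfolding sim \<rho>(1) by simp
  moreover have "positive_vector (real \<rho>, real \<rho>')" using \<rho>(2) by (simp add: positive_vector_def)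
  moreover have "C \<le> card (states N \<times> states N')" using belt_width_le_card assms(5-7) by simp
  ultimately show ?thesis using \<rho>(3,4) by blast
qed

end
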